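(* For any $z\in\mathbb{C}\setminus\{-1,-3,-5,\ldots\}$ and any integer $p\geq 0$, \[ \sum_{k=0}^\infty\frac{\binom{2k}{k}}{4^k(2k+1+z)^{p+1}} =\frac{(-1)^p\sqrt{\pi}}{2\,p!} \cdot\frac{\Gamma(\frac{z+1}{2})}{\Gamma(\frac{z+2}{2})} \cdot B_{p}\big(g^{(1)}(z),\ldots,g^{(p)}(z)\big), \] where for $k\geq 1$, \[ g^{(k)}(z)= 2^{-k}\left(\psi^{(k-1)}(\tfrac{z+1}{2})-\psi^{(k-1)}(\tfrac{z+2}{2})\right). \]
   Context: $\Gamma$ is Euler's gamma function and $\psi^{(m)}(z)=\frac{d^{m+1}}{dz^{m+1}}\log\Gamma(z)$ is the polygamma function ($\psi^{(0)}=\psi=\Gamma'/\Gamma$). The complete exponential Bell polynomials $B_n(x_1,\ldots,x_n)$ are defined by $\exp\left(\sum_{k\ge1}x_k\frac{t^k}{k!}\right)=\sum_{n\ge0}B_n(x_1,\ldots,x_n)\frac{t^n}{n!}$; equivalently $B_n=n!\sum\prod_{i=1}^n\frac{1}{j_i!}\left(\frac{x_i}{i!}\right)^{j_i}$, summed over nonnegative integers $j_1,\dots,j_n$ with $j_1+2j_2+\cdots+nj_n=n$; $B_0=1$. At points where $\frac{z+2}{2}$ is a nonpositive integer, the right-hand side is understood as its limiting value. *)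

theory Defs
  imports "HOL-Analysis.Analysis" "HOL-Computational_Algebra.Formal_Power_Series"
begin

text \<open>
  The complete exponential Bell polynomial \<open>B\<^sub>n(x\<^sub>1,\<dots>,x\<^sub>n)\<close>, read off from its exponential
  generating function. The arguments are passed as a function \<open>x\<close> whose value at \<open>k\<close> is the \<open>k\<close>-th
  argument; the result depends on \<open>x 1, \<dots>, x n\<close> only (in particular \<open>x 0\<close> is never used).
\<close>
definition complete_bell :: "nat \<Rightarrow> (nat \<Rightarrow> 'a :: field_char_0) \<Rightarrow> 'a" where
  "complete_bell n x =
     fact n * fps_nth (fps_exp 1 oo Abs_fps (\<lambda>k. if k = 0 then 0 else x k / fact k)) n"

lemma complete_bell_0: "complete_bell 0 x = 1"
  by (simp add: complete_bell_def)

lemma complete_bell_2: "complete_bell 2 x = x 1 ^ 2 + x 2"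
  by (simp add: complete_bell_def fps_compose_nth power2_eq_square fps_mult_nth
      numeral_2_eq_2 algebra_simps)

lemma complete_bell_cong:
  fixes x y :: "nat \<Rightarrow> 'a :: field_char_0"
  assumes "\<And>k. 1 \<le> k \<Longrightarrow> k \<le> n \<Longrightarrow> x k = y k"
  shows "complete_bell n x = complete_bell n y"
proof -
  define X where "X = (\<lambda>x :: nat \<Rightarrow> 'a. Abs_fps (\<lambda>k. if k = 0 then 0 else x k / fact k))"
  have pow: "fps_nth (X x ^ i) m = fps_nth (X y ^ i) m" if "m \<le> n" for i m
    using that
  proof (induction i arbitrary: m)
    case (Suc i)
    then show ?case
      by (auto simp: fps_mult_nth X_def assms intro!: sum.cong)
  qed simp
  show ?thesis
    using pow by (simp add: complete_bell_def fps_compose_nth X_def)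
qed

text \<open>\<open>g_deriv k z\<close> is \<open>g\<^sup>(\<^sup>k\<^sup>)(z)\<close>; it is meaningful only for \<open>k \<ge> 1\<close>.\<close>
definition g_deriv :: "nat \<Rightarrow> complex \<Rightarrow> complex" where
  "g_deriv k z = (Polygamma (k - 1) ((z + 1) / 2) - Polygamma (k - 1) ((z + 2) / 2)) / 2 ^ k"

text \<open>
  The right-hand side as a formula. It has the intended meaning where neither \<open>(z + 1) / 2\<close> nor
  \<open>(z + 2) / 2\<close> is a nonpositive integer; where only the latter is one, the limit has to be used.
\<close>
definition gamma_bell :: "nat \<Rightarrow> complex \<Rightarrow> complex" where
  "gamma_bell p z =
     (-1) ^ p * of_real (sqrt pi) / (2 * fact p) * (Gamma ((z + 1) / 2) / Gamma ((z + 2) / 2)) *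
     complete_bell p (\<lambda>k. g_deriv k z)"

end

theory Submission
  imports Defs "HOL-Complex_Analysis.Complex_Analysis"
begin

text \<open>
  Let \<open>F\<^sub>p(z)\<close> be the sum of the series. It converges locally uniformly because the coefficients
  are \<open>O(k\<^bsup>-1/2\<^esup>)\<close>, so \<open>F\<^sub>p' = -(p + 1) F\<^sub>p\<^sub>+\<^sub>1\<close> and \<open>F\<^sub>p\<close> is, up to the factor \<open>(-1)\<^sup>p p!\<close>, the
  \<open>p\<close>-th derivative of \<open>F\<^sub>0\<close>. For real \<open>z > 0\<close>, integrating the binomial series of
  \<open>t\<^bsup>(z-1)/2\<^esup> (1 - t)\<^bsup>-1/2\<^esup>\<close> termwise gives \<open>F\<^sub>0\<close> as half a Beta value, and analytic continuation
  extends this to the whole domain. Since the logarithmic derivative of the Beta value is \<open>g\<^sup>(\<^sup>1\<^sup>)\<close>,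
  Leibniz' rule and the recurrence of the Bell polynomials show that the \<open>p\<close>-th derivative of \<open>F\<^sub>0\<close>
  is \<open>F\<^sub>0\<close> times \<open>B\<^sub>p\<close>. The exceptional points are handled by continuity of \<open>F\<^sub>p\<close>.
\<close>

section \<open>Central binomial coefficients: size and generating function\<close>

definition central_coeff :: "nat \<Rightarrow> 'a :: field_char_0" where
  "central_coeff k = of_nat ((2 * k) choose k) / 4 ^ k"

text \<open>Duplication formula for (2k)!. The Pochhammer form gives the ratio of consecutive
  coefficients and the link to the binomial series.\<close>

lemma central_coeff_eq_pochhammer:
  "central_coeff k = (pochhammer (1 / 2) k / fact k :: 'a :: field_char_0)"
proof -
  have "(of_nat ((2 * k) choose k) :: 'a) = fact (2 * k) / (fact k * fact k)"
    by (subst binomial_fact) (auto simp: mult_2)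
  then show ?thesis
    by (simp add: central_coeff_def fact_double power_mult)
qed

lemma central_coeff_nonneg: "central_coeff k \<ge> (0 :: real)"
  by (simp add: central_coeff_def)

lemma of_real_central_coeff:
  "of_real (central_coeff k) = (central_coeff k :: 'a :: {real_field, field_char_0})"
  by (simp add: central_coeff_def)

text \<open>The quantity \<open>central_coeff k ^ 2 * (2 * k + 1)\<close> starts at 1 and decreases,
  because (2k+1)(2k+3) < (2k+2)^2. The resulting decay k^(-1/2) is what makes the series converge
  even for p = 0.\<close>

lemma central_coeff_le: "central_coeff k \<le> 1 / sqrt (2 * real k + 1)"
proof -
  have "central_coeff k ^ 2 * (2 * real k + 1) \<le> 1"
  proof (induction k)
    case (Suc k)
    have step: "central_coeff (Suc k) = central_coeff k * ((2 * real k + 1) / (2 * real k + 2))"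
      by (simp add: central_coeff_eq_pochhammer pochhammer_rec' field_simps)
    have "central_coeff (Suc k) ^ 2 * (2 * real (Suc k) + 1) =
            (central_coeff k ^ 2 * (2 * real k + 1)) *
            ((2 * real k + 1) * (2 * real k + 3) / (2 * real k + 2) ^ 2)"
      unfolding step by (simp add: power2_eq_square)
    also have "\<dots> \<le> 1 * 1"
    proof (intro mult_mono Suc.IH)
      have "(2 * real k + 1) * (2 * real k + 3) \<le> (2 * real k + 2) ^ 2"
        by (simp add: algebra_simps power2_eq_square)
      then show "(2 * real k + 1) * (2 * real k + 3) / (2 * real k + 2) ^ 2 \<le> 1"
        by (simp add: divide_le_eq_1)
    qed auto
    finally show ?case by simp
  qed (simp add: central_coeff_def)
  then have "central_coeff k ^ 2 \<le> (1 / sqrt (2 * real k + 1)) ^ 2"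
    by (simp add: field_simps power_divide)
  then show ?thesis
    by (rule power2_le_imp_le) simp
qed

text \<open>Binomial series with exponent -1/2 at -t: the two alternating signs cancel.\<close>

lemma central_coeff_sums:
  assumes "\<bar>t\<bar> < (1 :: real)"
  shows "(\<lambda>k. central_coeff k * t ^ k) sums (1 - t) powr (- 1 / 2)"
proof -
  have "(- 1 / 2 gchoose k) * (- t) ^ k = central_coeff k * t ^ k" for k
    by (simp add: gbinomial_pochhammer central_coeff_eq_pochhammer power_minus[of t])
  then show ?thesis
    using gen_binomial_real[of "- t" "- 1 / 2"] assms by simp
qed

section \<open>Termwise integration to a Beta value\<close>

lemma central_coeff_sums_Beta:
  assumes "a > (0 :: real)"
  shows "(\<lambda>k. central_coeff k / (of_nat k + a)) sums Beta a (1 / 2)"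
proof -
  define f where "f N t = (\<Sum>k<N. central_coeff k * t powr (of_nat k + a - 1))" for N and t :: real
  define g where "g t = t powr (a - 1) * (1 - t) powr (1 / 2 - 1)" for t :: real
  \<comment> \<open>Integrals are moved to the open interval because the series for \<open>g\<close>
    diverges at t = 1.\<close>
  have g: "(g has_integral Beta a (1 / 2)) {0<..<1}"
    unfolding g_def has_integral_Icc_iff_Ioo[symmetric]
    by (rule has_integral_Beta_real) (use assms in auto)
  have f: "(f N has_integral (\<Sum>k<N. central_coeff k / (of_nat k + a))) {0<..<1}" for N
    unfolding f_def has_integral_Icc_iff_Ioo[symmetric]
  proof (intro has_integral_sum)
    fix k
    show "((\<lambda>t. central_coeff k * t powr (of_nat k + a - 1)) has_integral
             central_coeff k / (of_nat k + a)) {0..1}"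
      using has_integral_mult_right[OF has_integral_powr_from_0[of "of_nat k + a - 1" 1],
          of "central_coeff k"] assms
      by simp
  qed simp
  have sums: "(\<lambda>k. central_coeff k * t powr (of_nat k + a - 1)) sums g t" if "t \<in> {0<..<1}" for t
  proof -
    have "t powr (of_nat k + a - 1) = t powr (a - 1) * t ^ k" for k
      using that by (simp add: powr_realpow[symmetric] powr_add[symmetric] algebra_simps)
    then show ?thesis
      using sums_mult[OF central_coeff_sums[of t], of "t powr (a - 1)"] that
      by (simp add: g_def mult_ac)
  qed
  \<comment> \<open>All terms are nonnegative, so the limit \<open>g\<close> itself dominates the
    partial sums.\<close>
  have "norm (f N t) \<le> g t" if "t \<in> {0<..<1}" for N t
  proof -
    have "f N t \<ge> 0"
      unfolding f_def by (intro sum_nonneg mult_nonneg_nonneg central_coeff_nonneg) auto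
    moreover have "f N t \<le> g t"
      unfolding f_def sums_unique[OF sums[OF that]]
      by (intro sum_le_suminf sums_summable[OF sums[OF that]])
         (auto intro: mult_nonneg_nonneg central_coeff_nonneg)
    ultimately show ?thesis by simp
  qed
  moreover have "(\<lambda>N. f N t) \<longlonglongrightarrow> g t" if "t \<in> {0<..<1}" for t
    using sums[OF that] by (simp add: sums_def f_def)
  ultimately have "(\<lambda>N. integral {0<..<1} (f N)) \<longlonglongrightarrow> integral {0<..<1} g"
    using f g by (intro dominated_convergence(2)[where h = g]) blast+
  then show ?thesis
    by (simp add: sums_def integral_unique[OF f] integral_unique[OF g])
qed

section \<open>The domain of the series\<close>

text \<open>Passes from the excluded odd integers to the poles of the Gamma factor, the form in
  which the domain is used below.\<close>

lemma half_notin_nonpos_Ints_iff: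
  fixes z :: "'a :: field_char_0"
  shows "(z + 1) / 2 \<notin> \<int>\<^sub>\<le>\<^sub>0 \<longleftrightarrow> z \<notin> {- of_nat (2 * n + 1) | n. True}"
proof -
  have "(z + 1) / 2 = - of_nat n \<longleftrightarrow> z = - of_nat (2 * n + 1)" for n
    by (auto simp: field_simps eq_neg_iff_add_eq_0)
  then show ?thesis
    by (auto elim!: nonpos_Ints_cases')
qed

lemma odd_shift_nonzero:
  fixes z :: "'a :: field_char_0"
  assumes "(z + 1) / 2 \<notin> \<int>\<^sub>\<le>\<^sub>0"
  shows "2 * of_nat k + 1 + z \<noteq> 0"
proof
  assume "2 * of_nat k + 1 + z = 0"
  then have "z + of_nat (2 * k + 1) = 0"
    by (simp add: add_ac)
  then have "z = - of_nat (2 * k + 1)"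
    by (simp only: eq_neg_iff_add_eq_0)
  with assms show False
    unfolding half_notin_nonpos_Ints_iff by blast
qed

text \<open>The shift \<open>c\<close> is kept free: c = 1 describes the domain, c = 2 the
  complement of the exceptional points.\<close>

lemma open_half_notin_nonpos_Ints:
  "open {z :: complex. (z + c) / 2 \<notin> \<int>\<^sub>\<le>\<^sub>0}"
proof -
  have "open ((\<lambda>z :: complex. (z + c) / 2) -` (- \<int>\<^sub>\<le>\<^sub>0))"
    by (intro open_vimage continuous_intros) (auto simp: open_Compl)
  then show ?thesis by (simp add: vimage_def)
qed

section \<open>Local uniform convergence and termwise differentiation\<close>

text \<open>The hypothesis keeps the modulus of 2k+1+y at least k, and k is at least 1, so a higher
  power only helps and the bound is free of p. The coefficient contributes the remaining
  k^(-1/2).\<close>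

lemma central_term_bound:
  fixes y :: complex
  assumes "norm y + 1 \<le> real k"
  shows "norm (central_coeff k / (2 * of_nat k + 1 + y) ^ (p + 1)) \<le> real k powr (- 3 / 2)"
proof -
  have k: "real k \<ge> 1" using assms norm_ge_zero[of y] by linarith
  have "real k \<le> norm (2 * of_nat k + 1 :: complex) - norm y"
    using assms norm_of_nat[of "2 * k + 1", where 'a = complex] by (simp add: add.commute)
  also have "\<dots> \<le> norm (2 * of_nat k + 1 + y)"
    by (rule norm_diff_ineq)
  finally have le: "real k \<le> norm (2 * of_nat k + 1 + y)" .
  also have "\<dots> \<le> norm (2 * of_nat k + 1 + y) ^ (p + 1)"
    using k le by (intro self_le_power) auto
  finally have "real k \<le> norm (2 * of_nat k + 1 + y) ^ (p + 1)" .
  moreover have "norm (central_coeff k :: complex) \<le> 1 / sqrt (real k)"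
  proof -
    have "norm (central_coeff k :: complex) = \<bar>central_coeff k\<bar>"
      by (subst of_real_central_coeff[symmetric]) (rule norm_of_real)
    also have "\<dots> = central_coeff k"
      by (simp add: central_coeff_nonneg)
    also have "\<dots> \<le> 1 / sqrt (2 * real k + 1)"
      by (rule central_coeff_le)
    also have "\<dots> \<le> 1 / sqrt (real k)"
      using k by (intro divide_left_mono) auto
    finally show ?thesis .
  qed
  ultimately have "norm (central_coeff k / (2 * of_nat k + 1 + y) ^ (p + 1))
     \<le> (1 / sqrt (real k)) / real k"
    unfolding norm_divide norm_power using k by (intro frac_le) auto
  also have "\<dots> = real k powr - (1 / 2) * real k powr - 1"
    using k by (simp add: powr_minus_divide powr_half_sqrt)
  also have "\<dots> = real k powr (- 3 / 2)"
    by (subst powr_add[symmetric]) simp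
  finally show ?thesis .
qed

definition central_series :: "nat \<Rightarrow> complex \<Rightarrow> complex" where
  "central_series p z = (\<Sum>k. central_coeff k / (2 * of_nat k + 1 + z) ^ (p + 1))"

text \<open>Both claims come from one application of the comparison test for a series and its
  derivative, since differentiating a term raises p by one and multiplies by -(p+1).\<close>

lemma
  assumes "(z + 1) / 2 \<notin> \<int>\<^sub>\<le>\<^sub>0"
  shows central_series_sums:
      "(\<lambda>k. central_coeff k / (2 * of_nat k + 1 + z) ^ (p + 1)) sums central_series p z"
    and has_field_derivative_central_series:
      "(central_series p has_field_derivative - of_nat (p + 1) * central_series (p + 1) z) (at z)"
proof -
  define S where "S = {z :: complex. (z + 1) / 2 \<notin> \<int>\<^sub>\<le>\<^sub>0}"
  define f where "f p k z = central_coeff k / (2 * of_nat k + 1 + z) ^ (p + 1)" for p k and z :: complex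
  have "\<exists>g g'. \<forall>x \<in> S. (\<lambda>k. f p k x) sums g x \<and>
          (\<lambda>k. - of_nat (p + 1) * f (p + 1) k x) sums g' x \<and> (g has_field_derivative g' x) (at x)" for p
  proof (rule series_and_derivative_comparison_local)
    show "open S"
      unfolding S_def by (rule open_half_notin_nonpos_Ints)
    show "(f p k has_field_derivative - of_nat (p + 1) * f (p + 1) k x) (at x)" if "x \<in> S" for k x
    proof -
      define h where "h z = 2 * of_nat k + 1 + z" for z :: complex
      have "(h has_field_derivative 1) (at x)"
        unfolding h_def by (auto intro!: derivative_eq_intros)
      moreover have "h x \<noteq> 0"
        unfolding h_def using that by (intro odd_shift_nonzero) (simp add: S_def)
      ultimately have "((\<lambda>z. central_coeff k / h z ^ (p + 1)) has_field_derivative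
          - of_nat (p + 1) * (central_coeff k / h x ^ (p + 1 + 1))) (at x)"
        by (cases p)
             (auto intro!: derivative_eq_intros simp: divide_simps, simp_all add: algebra_simps,
              metis One_nat_def power_eq_if)
      then show ?thesis
        by (simp add: f_def[abs_def] h_def)
    qed
    show "\<exists>d h. 0 < d \<and> summable h \<and>
            (\<forall>\<^sub>F k in sequentially. \<forall>y\<in>ball x d \<inter> S. norm (f p k y) \<le> h k)" for x
    proof (intro exI conjI)
      show "summable (\<lambda>k. real k powr (- 3 / 2))"
        by (simp add: summable_real_powr_iff)
      \<comment> \<open>On the unit ball around x the norm of y is below |x| + 1, so k at or above
        |x| + 2 meets the hypothesis of \<open>central_term_bound\<close>.\<close>
      show "\<forall>\<^sub>F k in sequentially. \<forall>y\<in>ball x 1 \<inter> S. norm (f p k y) \<le> real k powr (- 3 / 2)"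
        using eventually_ge_at_top[of "nat \<lceil>norm x + 2\<rceil>"]
      proof eventually_elim
        case (elim k)
        show ?case
        proof
          fix y assume "y \<in> ball x 1 \<inter> S"
          then have "norm (y - x) \<le> 1" by (simp add: dist_norm norm_minus_commute)
          then have "norm y + 1 \<le> norm x + 2" using norm_triangle_sub[of y x] by linarith
          with elim have "norm y + 1 \<le> real k" by linarith
          then show "norm (f p k y) \<le> real k powr (- 3 / 2)"
            unfolding f_def by (rule central_term_bound)
        qed
      qed
    qed simp
  qed
  then obtain g g' where
    g: "\<And>p x. x \<in> S \<Longrightarrow> (\<lambda>k. f p k x) sums g p x" and
    g': "\<And>p x. x \<in> S \<Longrightarrow> (\<lambda>k. - of_nat (p + 1) * f (p + 1) k x) sums g' p x" and
    deriv: "\<And>p x. x \<in> S \<Longrightarrow> (g p has_field_derivative g' p x) (at x)"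
    by metis
  have eq: "central_series p x = g p x" if "x \<in> S" for p x
    using sums_unique[OF g[OF that]] by (simp add: central_series_def f_def)
  have z: "z \<in> S" using assms by (simp add: S_def)
  show "(\<lambda>k. central_coeff k / (2 * of_nat k + 1 + z) ^ (p + 1)) sums central_series p z"
    using g[OF z] eq[OF z] by (simp add: f_def)
  \<comment> \<open>The series for \<open>g'\<close> is a constant multiple of the one for
    \<open>g (p + 1)\<close>, so uniqueness of sums identifies them.\<close>
  have "g' p z = - of_nat (p + 1) * central_series (p + 1) z"
    using sums_unique2[OF g'[OF z] sums_mult[OF g[OF z]]] eq[OF z] by simp
  moreover have "(central_series p has_field_derivative g' p z) (at z)"
    using deriv[OF z]
    by (rule has_field_derivative_transform_within_open[where S = S])
       (use z eq in \<open>auto simp: S_def open_half_notin_nonpos_Ints\<close>)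
  ultimately show "(central_series p has_field_derivative
      - of_nat (p + 1) * central_series (p + 1) z) (at z)" by simp
qed

section \<open>Closed form for p = 0 by analytic continuation\<close>

text \<open>Writing \<open>rGamma\<close>, which is entire, instead of a quotient keeps the
  right-hand side holomorphic at the exceptional points too, so the identity theorem covers the
  whole domain.\<close>

lemma central_series_0_eq:
  assumes "(z + 1) / 2 \<notin> \<int>\<^sub>\<le>\<^sub>0"
  shows "central_series 0 z = of_real (sqrt pi) / 2 * (Gamma ((z + 1) / 2) * rGamma ((z + 2) / 2))"
proof -
  define S where "S = {z :: complex. (z + 1) / 2 \<notin> \<int>\<^sub>\<le>\<^sub>0}"
  define h where "h z = central_series 0 z -
      of_real (sqrt pi) / 2 * (Gamma ((z + 1) / 2) * rGamma ((z + 2) / 2))" for z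
  \<comment> \<open>A real segment on which the Beta formula applies and which accumulates at
    1.\<close>
  define U where "U = complex_of_real ` {0<..<2}"
  have "h z = 0"
  proof (rule analytic_continuation[where f = h and S = S and U = U and \<xi> = 1])
    show "open S"
      unfolding S_def by (rule open_half_notin_nonpos_Ints)
    have "S = UNIV - range (\<lambda>n. - of_nat (2 * n + 1))"
      unfolding S_def half_notin_nonpos_Ints_iff by auto
    \<comment> \<open>Removing countably many points from the plane leaves a connected set.\<close>
    then show "connected S"
      by (simp only:) (intro connected_open_diff_countable countable_image, auto)
    have "central_series 0 holomorphic_on S"
      unfolding holomorphic_on_open[OF \<open>open S\<close>]
      using has_field_derivative_central_series[of _ 0] by (auto simp: S_def)
    then show "h holomorphic_on S"
      unfolding h_def by (intro holomorphic_intros) (auto simp: S_def)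
    show "U \<subseteq> S"
    proof
      fix x assume "x \<in> U"
      then obtain r where "x = of_real r" "0 < r" by (auto simp: U_def)
      then have "(x + 1) / 2 \<notin> \<real>\<^sub>\<le>\<^sub>0"
        by (simp add: complex_nonpos_Reals_iff)
      then show "x \<in> S"
        unfolding S_def using nonpos_Ints_subset_nonpos_Reals by blast
    qed
    moreover have one: "1 \<in> U"
      unfolding U_def by (rule image_eqI[of _ _ 1]) auto
    ultimately show "1 \<in> S" by blast
    \<comment> \<open>A connected set with more than one point has no isolated points; 1/2 serves as
      the second point.\<close>
    show "1 islimpt U"
    proof (rule connected_imp_perfect)
      show "connected U"
        unfolding U_def by (intro connected_continuous_image continuous_intros) auto
      have "of_real (1 / 2) \<in> U"
        unfolding U_def by (rule imageI) simp
      then show "U \<noteq> {x}" for x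
        using one by force
    qed (rule one)
    show "h x = 0" if "x \<in> U" for x
    proof -
      from that obtain r where r: "x = of_real r" "0 < r" by (auto simp: U_def)
      \<comment> \<open>The factor 1/2 comes from 2k+1+r = 2(k + (r+1)/2).\<close>
      have "(\<lambda>k. 1 / 2 * (central_coeff k / (of_nat k + (r + 1) / 2))) sums
          (1 / 2 * Beta ((r + 1) / 2) (1 / 2))"
        using r by (intro sums_mult central_coeff_sums_Beta) auto
      then have "(\<lambda>k. of_real (1 / 2 * (central_coeff k / (of_nat k + (r + 1) / 2)))) sums
            complex_of_real (1 / 2 * Beta ((r + 1) / 2) (1 / 2))"
        by (rule sums_of_real)
      also have "(\<lambda>k. complex_of_real (1 / 2 * (central_coeff k / (of_nat k + (r + 1) / 2)))) =
            (\<lambda>k. central_coeff k / (2 * of_nat k + 1 + x) ^ (0 + 1))"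
        using r by (auto simp: of_real_central_coeff field_simps)
      finally have "central_series 0 x = of_real (1 / 2 * Beta ((r + 1) / 2) (1 / 2))"
        using sums_unique2 central_series_sums \<open>U \<subseteq> S\<close> that S_def by blast
      also have "\<dots> = of_real (sqrt pi) / 2 * (Gamma ((x + 1) / 2) * rGamma ((x + 2) / 2))"
      proof -
        have "(x + 1) / 2 = of_real ((r + 1) / 2)" "(x + 2) / 2 = of_real ((r + 1) / 2 + 1 / 2)"
          using r by (simp_all add: add_divide_distrib)
        then show ?thesis
          unfolding Beta_altdef
          by (simp only: Gamma_complex_of_real rGamma_complex_of_real Gamma_one_half_real) simp
      qed
      finally show ?thesis by (simp add: h_def)
    qed
  qed (use assms in \<open>auto simp: S_def\<close>)
  then show ?thesis by (simp add: h_def)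
qed

section \<open>Bell polynomials and higher derivatives\<close>

text \<open>Compare coefficients in E' = E A', where E = exp(A) is the exponential generating
  function.\<close>

lemma complete_bell_Suc:
  "complete_bell (Suc n) x =
     (\<Sum>k\<le>n. of_nat (n choose k) * complete_bell k x * x (Suc (n - k)))"
proof -
  define A where "A = Abs_fps (\<lambda>k. if k = 0 then 0 else x k / fact k)"
  define E where "E = fps_exp 1 oo A"
  have B: "complete_bell m x = fact m * fps_nth E m" for m
    by (simp add: complete_bell_def E_def A_def)
  have deriv_A: "fps_nth (fps_deriv A) m = x (Suc m) / fact m" for m
  proof -
    have "of_nat (Suc m) \<noteq> (0 :: 'a)" by (simp only: of_nat_eq_0_iff)
    then show ?thesis by (simp add: A_def divide_simps)
  qed
  have "fps_deriv E = E * fps_deriv A"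
    unfolding E_def by (subst fps_compose_deriv) (simp_all add: A_def)
  then have "of_nat (Suc n) * fps_nth E (Suc n) = fps_nth (E * fps_deriv A) n"
    by (metis fps_deriv_nth Suc_eq_plus1)
  then have "of_nat (Suc n) * fps_nth E (Suc n) =
       (\<Sum>k\<le>n. fps_nth E k * (x (Suc (n - k)) / fact (n - k)))"
    by (simp only: fps_mult_nth deriv_A atLeast0AtMost)
  then have "fact n * (of_nat (Suc n) * fps_nth E (Suc n)) =
       fact n * (\<Sum>k\<le>n. fps_nth E k * (x (Suc (n - k)) / fact (n - k)))" by simp
  moreover have "fact n * (\<Sum>k\<le>n. fps_nth E k * (x (Suc (n - k)) / fact (n - k))) =
    (\<Sum>k\<le>n. of_nat (n choose k) * complete_bell k x * x (Suc (n - k)))"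
    unfolding sum_distrib_left
    by (intro sum.cong refl) (simp add: B binomial_fact)
  ultimately show ?thesis
    by (simp add: B mult_ac)
qed

text \<open>Leibniz' rule applied to F' = F g_1 yields the recurrence
  \<open>complete_bell_Suc\<close>. The induction is strong because all lower derivatives of F
  occur.\<close>

lemma higher_deriv_eq_complete_bell:
  fixes F :: "complex \<Rightarrow> complex"
  assumes "open S" "z \<in> S"
    and F: "\<And>w. w \<in> S \<Longrightarrow> (F has_field_derivative F w * g 1 w) (at w)"
    and g: "\<And>k w. w \<in> S \<Longrightarrow> k \<ge> 1 \<Longrightarrow> (g k has_field_derivative g (Suc k) w) (at w)"
  shows "(deriv ^^ n) F z = F z * complete_bell n (\<lambda>k. g k z)"
proof -
  have holo: "F holomorphic_on S" "g 1 holomorphic_on S"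
    using F g[of _ 1] assms(1) by (auto simp: holomorphic_on_open)
  have g_higher: "(deriv ^^ j) (g 1) w = g (Suc j) w" if "w \<in> S" for j w
    using that
  proof (induction j arbitrary: w)
    case (Suc j)
    have "eventually (\<lambda>u. (deriv ^^ j) (g 1) u = g (Suc j) u) (nhds w)"
      using eventually_nhds_in_open[OF assms(1) Suc.prems] by eventually_elim (rule Suc.IH)
    then have "(deriv ^^ Suc j) (g 1) w = deriv (g (Suc j)) w"
      by (simp add: deriv_cong_ev)
    also have "\<dots> = g (Suc (Suc j)) w"
      using g[OF Suc.prems, of "Suc j"] by (simp add: DERIV_imp_deriv)
    finally show ?case .
  qed simp
  show ?thesis
  proof (induction n rule: less_induct)
    case (less n)
    show ?case
    proof (cases n)
      case 0
      then show ?thesis by (simp add: complete_bell_0)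
    next
      case (Suc m)
      have "(deriv ^^ n) F z = (deriv ^^ m) (deriv F) z"
        unfolding Suc funpow_Suc_right by simp
      also have "\<dots> = (deriv ^^ m) (\<lambda>w. F w * g 1 w) z"
        using assms(1,2) holo F
        by (intro higher_deriv_transform_within_open[where S = S])
           (auto intro!: holomorphic_intros holomorphic_deriv DERIV_imp_deriv)
      also have "\<dots> = (\<Sum>k\<le>m. of_nat (m choose k) * (deriv ^^ k) F z * (deriv ^^ (m - k)) (g 1) z)"
        using assms(1,2) holo by (subst higher_deriv_mult[where S = S]) (auto simp: atLeast0AtMost)
      also have "\<dots> = (\<Sum>k\<le>m. F z * (of_nat (m choose k) *
          complete_bell k (\<lambda>k. g k z) * g (Suc (m - k)) z))"
        using assms(2) Suc by (intro sum.cong refl) (simp add: less.IH g_higher[unfolded One_nat_def] mult_ac)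
      finally show ?thesis
        by (simp add: Suc complete_bell_Suc sum_distrib_left)
    qed
  qed
qed

section \<open>The series as Gamma quotient times Bell polynomial\<close>

lemma higher_deriv_central_series:
  assumes "(z + 1) / 2 \<notin> \<int>\<^sub>\<le>\<^sub>0"
  shows "(deriv ^^ p) (central_series 0) z = (- 1) ^ p * fact p * central_series p z"
  using assms
proof (induction p arbitrary: z)
  case (Suc p)
  have "eventually (\<lambda>w. (w + 1) / 2 \<notin> \<int>\<^sub>\<le>\<^sub>0) (nhds z)"
    using eventually_nhds_in_open[OF open_half_notin_nonpos_Ints[of 1], of z] Suc.prems by simp
  then have "eventually (\<lambda>w. (deriv ^^ p) (central_series 0) w =
      (- 1) ^ p * fact p * central_series p w) (nhds z)"
    by eventually_elim (rule Suc.IH)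
  then have "(deriv ^^ Suc p) (central_series 0) z =
      deriv (\<lambda>w. (- 1) ^ p * fact p * central_series p w) z"
    by (simp add: deriv_cong_ev)
  also have "\<dots> = (- 1) ^ p * fact p * (- of_nat (p + 1) * central_series (p + 1) z)"
    by (intro DERIV_imp_deriv DERIV_cmult has_field_derivative_central_series Suc.prems)
  finally show ?case by (simp add: algebra_simps)
qed simp

text \<open>The inner factor 1/2 turns \<open>2 ^ k\<close> into \<open>2 ^ Suc k\<close>. For k = 0
  truncated subtraction would leave the Polygamma order at 0 on both sides.\<close>

lemma has_field_derivative_g_deriv:
  assumes "(z + 1) / 2 \<notin> \<int>\<^sub>\<le>\<^sub>0" "(z + 2) / 2 \<notin> \<int>\<^sub>\<le>\<^sub>0" "k \<ge> 1"
  shows "(g_deriv k has_field_derivative g_deriv (Suc k) z) (at z)"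
proof -
  obtain j where "k = Suc j" using assms(3) by (cases k) auto
  then show ?thesis
    unfolding g_deriv_def using assms(1,2)
    by (auto intro!: derivative_eq_intros simp: field_simps)
qed

text \<open>The logarithmic derivatives of \<open>Gamma\<close> and \<open>rGamma\<close> are
  Digamma and its negative; with the inner factor 1/2 they add up to
  \<open>g_deriv 1\<close>.\<close>

lemma has_field_derivative_central_series_0:
  assumes "(z + 1) / 2 \<notin> \<int>\<^sub>\<le>\<^sub>0" "(z + 2) / 2 \<notin> \<int>\<^sub>\<le>\<^sub>0"
  shows "(central_series 0 has_field_derivative central_series 0 z * g_deriv 1 z) (at z)"
proof -
  have "((\<lambda>z. of_real (sqrt pi) / 2 * (Gamma ((z + 1) / 2) * rGamma ((z + 2) / 2)))
      has_field_derivative central_series 0 z * g_deriv 1 z) (at z)"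
    unfolding central_series_0_eq[OF assms(1)] g_deriv_def using assms
    by (auto intro!: derivative_eq_intros simp: field_simps)
  then show ?thesis
    by (rule has_field_derivative_transform_within_open[OF _ open_half_notin_nonpos_Ints[of 1]])
       (use assms in \<open>auto simp: central_series_0_eq\<close>)
qed

lemma central_series_eq_gamma_bell:
  assumes "(z + 1) / 2 \<notin> \<int>\<^sub>\<le>\<^sub>0" "(z + 2) / 2 \<notin> \<int>\<^sub>\<le>\<^sub>0"
  shows "central_series p z = gamma_bell p z"
proof -
  define S where "S = {z :: complex. (z + 1) / 2 \<notin> \<int>\<^sub>\<le>\<^sub>0} \<inter> {z. (z + 2) / 2 \<notin> \<int>\<^sub>\<le>\<^sub>0}"
  define G where "G = Gamma ((z + 1) / 2) * rGamma ((z + 2) / 2)"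
  define B where "B = complete_bell p (\<lambda>k. g_deriv k z)"
  have "(deriv ^^ p) (central_series 0) z = central_series 0 z * B"
    unfolding B_def
  proof (rule higher_deriv_eq_complete_bell[where S = S])
    show "open S"
      unfolding S_def by (intro open_Int open_half_notin_nonpos_Ints)
  qed (use assms has_field_derivative_central_series_0 has_field_derivative_g_deriv
       in \<open>auto simp: S_def\<close>)
  then have "(- 1) ^ p * fact p * central_series p z = of_real (sqrt pi) / 2 * G * B"
    by (simp add: higher_deriv_central_series central_series_0_eq assms G_def)
  \<comment> \<open>The sign is its own inverse, so multiplying by it once more moves it to the
    right-hand side.\<close>
  then have "(- 1) ^ p * (- 1) ^ p * fact p * central_series p z =
      (- 1) ^ p * (of_real (sqrt pi) / 2 * G * B)"
    by (simp only: mult.assoc)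
  then have "fact p * central_series p z = (- 1) ^ p * (of_real (sqrt pi) / 2 * G * B)"
    by (simp add: power_mult_distrib[symmetric])
  then have "central_series p z = (- 1) ^ p * of_real (sqrt pi) / (2 * fact p) * G * B"
    by (simp add: divide_simps mult_ac)
  then show ?thesis
    by (simp only: gamma_bell_def G_def B_def rGamma_inverse_Gamma divide_inverse)
qed

section \<open>The full domain, with limits at the exceptional points\<close>

theorem theorem5p1:
  fixes z :: complex and p :: nat
  assumes "z \<notin> {- of_nat (2 * n + 1) | n. True}"
  shows "\<exists>S. (\<lambda>k. of_nat ((2 * k) choose k) / (4 ^ k * (2 * of_nat k + 1 + z) ^ (p + 1))) sums S \<and>
             (if (z + 2) / 2 \<in> \<int>\<^sub>\<le>\<^sub>0 then (gamma_bell p \<longlongrightarrow> S) (at z) else S = gamma_bell p z)"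
proof (intro exI conjI)
  have z: "(z + 1) / 2 \<notin> \<int>\<^sub>\<le>\<^sub>0"
    using assms by (simp only: half_notin_nonpos_Ints_iff not_False_eq_True)
  show "(\<lambda>k. of_nat ((2 * k) choose k) / (4 ^ k * (2 * of_nat k + 1 + z) ^ (p + 1)))
        sums central_series p z"
    using central_series_sums[OF z, of p] by (simp add: central_coeff_def)
  show "if (z + 2) / 2 \<in> \<int>\<^sub>\<le>\<^sub>0 then (gamma_bell p \<longlongrightarrow> central_series p z) (at z)
        else central_series p z = gamma_bell p z"
  proof (cases "(z + 2) / 2 \<in> \<int>\<^sub>\<le>\<^sub>0")
    case True
    have "(central_series p \<longlongrightarrow> central_series p z) (at z)"
      using DERIV_isCont[OF has_field_derivative_central_series[OF z]] by (simp add: isCont_def)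
    moreover have "eventually (\<lambda>w. (w + 1) / 2 \<notin> \<int>\<^sub>\<le>\<^sub>0) (at z)"
      using eventually_at_in_open'[OF open_half_notin_nonpos_Ints[of 1], of z] z by simp
    moreover have "eventually (\<lambda>w. (w + 2) / 2 \<notin> \<int>\<^sub>\<le>\<^sub>0) (at z)"
    proof -
      \<comment> \<open>Every set of integers is closed, so deleting the value at z from the
        nonpositive integers leaves a closed set that (w+2)/2 avoids for w near z.\<close>
      have "open ((\<lambda>w :: complex. (w + 2) / 2) -` (- (\<int>\<^sub>\<le>\<^sub>0 - {(z + 2) / 2})))"
        by (intro open_vimage continuous_intros open_Compl closed_subset_Ints) auto
      then have "eventually (\<lambda>w. w \<in> (\<lambda>w. (w + 2) / 2) -` (- (\<int>\<^sub>\<le>\<^sub>0 - {(z + 2) / 2})) - {z})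
          (at z)"
        by (rule eventually_at_in_open) simp
      then show ?thesis
        by (rule eventually_mono) auto
    qed
    ultimately have "(gamma_bell p \<longlongrightarrow> central_series p z) (at z)"
      by (elim Lim_transform_eventually)
         (auto elim: eventually_elim2 simp: central_series_eq_gamma_bell)
    with True show ?thesis by simp
  qed (simp add: central_series_eq_gamma_bell z)
qed

end
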